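(* Let $Y_1\neq Y_2$ be rays in $V$, let $\varepsilon_1\in Y_1$, $\varepsilon_2\in Y_2$ be vectors, and put $\alpha_1=q(\varepsilon_1)$, $\alpha_2=q(\varepsilon_2)$, $\alpha_{12}=b(\varepsilon_1,\varepsilon_2)$. Let $w\in V$ be a vector such that $b(\varepsilon_1,w)$ and $b(\varepsilon_2,w)$ are not both zero, and let $f_w:[0,\infty]\to R$ be the function $$f_w(\lambda)=\frac{b(\varepsilon_1,w)^2+\lambda^2 b(\varepsilon_2,w)^2}{(\alpha_1+\alpha_{12}\lambda+\alpha_2\lambda^2)\,q(w)}.$$ (a) Suppose $\alpha_1\alpha_2<\alpha_{12}^2$. Then $f_w$ is constant on $$A_w=\Big[0,\ \tfrac{b(\varepsilon_1,w)}{b(\varepsilon_2,w)}\wedge\tfrac{\alpha_1}{\alpha_{12}}\Big]\quad\text{and on}\quad C_w=\Big[\tfrac{b(\varepsilon_1,w)}{b(\varepsilon_2,w)}+\tfrac{\alpha_{12}}{\alpha_2},\ \infty\Big].$$ On $$B_w=\Big[\tfrac{b(\varepsilon_1,w)}{b(\varepsilon_2,w)}\wedge\tfrac{\alpha_1}{\alpha_{12}},\ \tfrac{b(\varepsilon_1,w)}{b(\varepsilon_2,w)}+\tfrac{\alpha_{12}}{\alpha_2}\Big]$$ $f_w$ is piecewise monomial and is not constant on any subinterval (with more than one point). (b) Suppose $\alpha_1\alpha_2\geq\alpha_{12}^2$. Then $f_w$ is constant on $$A_w=\Big[0,\ \tfrac{b(\varepsilon_1,w)}{b(\varepsilon_2,w)}\wedge\sqrt{\tfrac{\alpha_1}{\alpha_2}}\Big]\quad\text{and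 on}\quad C_w=\Big[\tfrac{b(\varepsilon_1,w)}{b(\varepsilon_2,w)}+\sqrt{\tfrac{\alpha_1}{\alpha_2}},\ \infty\Big].$$ On $$B_w=\Big[\tfrac{b(\varepsilon_1,w)}{b(\varepsilon_2,w)}\wedge\sqrt{\tfrac{\alpha_1}{\alpha_2}},\ \tfrac{b(\varepsilon_1,w)}{b(\varepsilon_2,w)}+\sqrt{\tfrac{\alpha_1}{\alpha_2}}\Big]$$ $f_w$ is piecewise monomial without being constant on any subinterval (with more than one point), provided that $B_w$ is not a singleton. If $B_w$ is a singleton, then $f_w$ is constant on $[0,\infty]$.
   Context: $R=\{0\}\cup G$ is a bipotent semifield: $G$ is a nontrivial totally ordered abelian group written multiplicatively with unit $e=1$, $0$ is absorbing and smaller than all elements of $G$, and addition is $x+y=\max\{x,y\}$. $R$ is assumed square closed: every element of $R$ has a (unique) square root in $R$. Write $[0,\infty]=R\cup\{\infty\}$ with $x<\infty$ for all $x\in R$, extend addition as maximum, and put $0^{-1}=\infty$, $\infty^{-1}=0$, $\gamma\cdot\infty=\infty$ for $\gamma\in G$. The symbol $\wedge$ means minimum; a quotient $a/0$ with $a\in G$ is read as $\infty$. $V$ is an $R$-module with a quadratic form $q:V\to R$, i.e. $q(\lambda x)=\lambda^2q(x)$, and a symmetric bilinear companion $b:V\times V\to R$, i.e. $q(x+y)=q(x)+q(y)+b(x,y)$ for all $x,y$. It is assumed that $q$ is anisotropic: $q(x)\ne 0$ for $x\neq0$. A ray in $V$ is a class of the equivalence relation on $V\setminus\{0\}$: $x\sim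 y$ iff $\lambda x=\mu y$ for some $\lambda,\mu\in R\setminus\{0\}$. The value $f_w(\infty)$ is read as $b(\varepsilon_2,w)^2/(\alpha_2q(w))$. A function $f:C\to[0,\infty]$ on a convex subset $C$ of $[0,\infty]$ is monomial (of degree $j\in\mathbb Z$) if there is $\gamma\in R\setminus\{0\}$ with $f(\lambda)=\gamma\lambda^j$ for all $\lambda\in C$ (with $\lambda^0=1$ for every $\lambda$). A function $f:[u,v]\to[0,\infty]$ is piecewise monomial if there is a finite sequence $u=\beta_0<\beta_1<\dots<\beta_r=v$ such that each restriction $f|[\beta_{s-1},\beta_s]$ is monomial. *)

theory Defs
  imports "HOL-Analysis.Analysis"
begin

text \<open>
  A bipotent semifield: every nonzero element is invertible and addition is the maximum, so that
  the nonzero elements form a totally ordered abelian group and \<open>0\<close> is the least element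
  (compatibility of the order with multiplication is distributivity).
  The value of \<open>inverse 0\<close> is left open.
\<close>

class bipotent_semifield = comm_semiring_1 + linorder + inverse +
  assumes add_eq_max: "x + y = max x y"
    and right_inverse_nonzero: "x \<noteq> 0 \<Longrightarrow> x * inverse x = 1"
    and divide_eq_times_inverse: "x / y = x * inverse y"
    and nontrivial_unit_group: "\<exists>x. x \<noteq> 0 \<and> x \<noteq> 1"

class square_closed_bipotent_semifield = bipotent_semifield +
  assumes ex_square_root: "\<exists>y. y\<^sup>2 = x"
begin

definition square_root :: "'a \<Rightarrow> 'a" where
  "square_root x = (THE y. y\<^sup>2 = x)"

end

lemma square_eq_imp_eq:
  fixes x y :: "'a::bipotent_semifield"
  assumes "x\<^sup>2 = y\<^sup>2"
  shows "x = y"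
proof -
  have inv: "a = 0 \<or> (\<exists>c. a * c = 1)" for a :: 'a
    using right_inverse_nonzero by blast
  have *: "x = y" if le: "x \<le> y" and sq: "x * x = y * y" for x y :: 'a
  proof (cases "y = 0")
    case True
    then have "x * x = 0" using sq by simp
    with inv[of x] have "x = 0"
      by (metis mult.assoc mult.right_neutral mult_zero_left)
    with True show ?thesis by simp
  next
    case False
    then obtain c where c: "y * c = 1" using inv[of y] by auto
    have xy: "x + y = y" using le by (simp add: add_eq_max max_def)
    have "x * y = x * y + y * y"
    proof -
      have "x * y = x * (x + y)" by (simp only: xy)
      also have "\<dots> = y * y + x * y" by (simp add: distrib_left sq)
      finally show ?thesis by (simp add: add.commute)
    qed
    also have "\<dots> = (x + y) * y" by (simp add: distrib_right)
    also have "\<dots> = y * y" by (simp only: xy)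
    finally have "x * y * c = y * y * c" by simp
    then show ?thesis by (simp add: mult.assoc c)
  qed
  from assms have "x * x = y * y" by (simp add: power2_eq_square)
  with *[of x y] *[of y x] show ?thesis by (metis linear)
qed

lemma square_root_power2: "(square_root x)\<^sup>2 = (x::'a::square_closed_bipotent_semifield)"
  unfolding square_root_def
  by (rule theI') (use ex_square_root square_eq_imp_eq in blast)


text \<open>The extended range \<open>[0,\<infinity>] = R \<union> {\<infinity>}\<close>.\<close>

datatype 'a with_infty = Fin 'a | Infty

instantiation with_infty :: (linorder) linorder
begin

fun less_eq_with_infty :: "'a with_infty \<Rightarrow> 'a with_infty \<Rightarrow> bool" where
  "Fin x \<le> Fin y \<longleftrightarrow> x \<le> y"
| "x \<le> Infty \<longleftrightarrow> True"
| "Infty \<le> Fin y \<longleftrightarrow> False"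

definition less_with_infty :: "'a with_infty \<Rightarrow> 'a with_infty \<Rightarrow> bool" where
  "x < y \<longleftrightarrow> x \<le> y \<and> \<not> y \<le> (x :: 'a with_infty)"

instance
proof
  fix x y z :: "'a with_infty"
  show "x < y \<longleftrightarrow> x \<le> y \<and> \<not> y \<le> x" by (rule less_with_infty_def)
  show "x \<le> x" by (cases x) auto
  show "x \<le> y \<Longrightarrow> y \<le> z \<Longrightarrow> x \<le> z" by (cases x; cases y; cases z) auto
  show "x \<le> y \<Longrightarrow> y \<le> x \<Longrightarrow> x = y" by (cases x; cases y) auto
  show "x \<le> y \<or> y \<le> x" by (cases x; cases y) auto
qed

end

instantiation with_infty :: (zero) zero
begin
definition "0 = Fin 0"
instance ..
end

instantiation with_infty :: (one) one
begin
definition "1 = Fin 1"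
instance ..
end

instantiation with_infty :: (plus) plus
begin
fun plus_with_infty :: "'a with_infty \<Rightarrow> 'a with_infty \<Rightarrow> 'a with_infty" where
  "Fin x + Fin y = Fin (x + y)"
| "x + Infty = Infty"
| "Infty + Fin y = Infty"
instance ..
end

lemma plus_with_infty_eq_max:
  "x + y = max x (y :: 'a::bipotent_semifield with_infty)"
  by (cases x; cases y) (auto simp: add_eq_max max_def)

text \<open>The product \<open>0 \<cdot> \<infinity>\<close> is never needed; it is set to \<open>0\<close>.\<close>

instantiation with_infty :: ("{zero,times}") times
begin
fun times_with_infty :: "'a with_infty \<Rightarrow> 'a with_infty \<Rightarrow> 'a with_infty" where
  "Fin x * Fin y = Fin (x * y)"
| "Fin x * Infty = (if x = 0 then Fin 0 else Infty)"
| "Infty * Fin y = (if y = 0 then Fin 0 else Infty)"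
| "Infty * Infty = Infty"
instance ..
end

instance with_infty :: ("{zero,one,times}") power ..

text \<open>
  With \<open>inverse 0 = \<infinity>\<close> and \<open>inverse \<infinity> = 0\<close>, the library's integer power
  \<open>t powi j\<close> is the monomial \<open>t\<^sup>j\<close> on all of \<open>[0,\<infinity>]\<close>, and \<open>a / 0 = \<infinity>\<close> for \<open>a \<noteq> 0\<close>.
\<close>

instantiation with_infty :: ("{zero,times,inverse}") inverse
begin
fun inverse_with_infty :: "'a with_infty \<Rightarrow> 'a with_infty" where
  "inverse (Fin x) = (if x = 0 then Infty else Fin (inverse x))"
| "inverse Infty = Fin 0"
definition divide_with_infty :: "'a with_infty \<Rightarrow> 'a with_infty \<Rightarrow> 'a with_infty" where
  "divide x y = x * inverse (y :: 'a with_infty)"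
instance ..
end

definition order_convex :: "'a::order set \<Rightarrow> bool" where
  "order_convex C \<longleftrightarrow> (\<forall>x\<in>C. \<forall>y\<in>C. {x..y} \<subseteq> C)"

definition monomial_on ::
  "('a::bipotent_semifield with_infty \<Rightarrow> 'a with_infty) \<Rightarrow> 'a with_infty set \<Rightarrow> bool" where
  "monomial_on f C \<longleftrightarrow>
     (\<exists>(\<gamma>::'a) (j::int). \<gamma> \<noteq> 0 \<and> (\<forall>t\<in>C. f t = Fin \<gamma> * t powi j))"

definition piecewise_monomial ::
  "('a::bipotent_semifield with_infty \<Rightarrow> 'a with_infty) \<Rightarrow> 'a with_infty \<Rightarrow> 'a with_infty \<Rightarrow> bool"
  where
  "piecewise_monomial f u v \<longleftrightarrow>
     (\<exists>(r::nat) \<beta>. \<beta> 0 = u \<and> \<beta> r = v \<and>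
        (\<forall>s<r. \<beta> s < \<beta> (Suc s) \<and> monomial_on f {\<beta> s..\<beta> (Suc s)}))"


text \<open>
  The module is the whole type \<open>'v\<close>; the library's modules require additive inverses, which
  are not available here.
\<close>

locale semimodule =
  fixes smul :: "'a::comm_semiring_1 \<Rightarrow> 'v::comm_monoid_add \<Rightarrow> 'v"  (infixr "*m" 75)
  assumes scale_add_right: "a *m (x + y) = a *m x + a *m y"
    and scale_add_left: "(a + c) *m x = a *m x + c *m x"
    and scale_scale: "a *m c *m x = (a * c) *m x"
    and scale_one: "1 *m x = x"
    and scale_zero_left: "0 *m x = 0"
    and scale_zero_right: "a *m 0 = 0"

text \<open>A quadratic form \<open>q\<close> together with a chosen symmetric bilinear companion \<open>b\<close>.\<close>

locale quadratic_module = semimodule smul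
  for smul :: "'a::comm_semiring_1 \<Rightarrow> 'v::comm_monoid_add \<Rightarrow> 'v"  (infixr "*m" 75) +
  fixes q :: "'v \<Rightarrow> 'a" and b :: "'v \<Rightarrow> 'v \<Rightarrow> 'a"
  assumes quadratic_scale: "q (a *m x) = a\<^sup>2 * q x"
    and bilinear_add_left: "b (x + y) z = b x z + b y z"
    and bilinear_scale_left: "b (a *m x) z = a * b x z"
    and bilinear_sym: "b x y = b y x"
    and companion: "q (x + y) = q x + q y + b x y"

definition anisotropic :: "('v::zero \<Rightarrow> 'a::zero) \<Rightarrow> bool" where
  "anisotropic q \<longleftrightarrow> (\<forall>x. x \<noteq> 0 \<longrightarrow> q x \<noteq> 0)"

definition ray_rel ::
  "('a::comm_semiring_1 \<Rightarrow> 'v::comm_monoid_add \<Rightarrow> 'v) \<Rightarrow> ('v \<times> 'v) set" where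
  "ray_rel smul = {(x, y). x \<noteq> 0 \<and> y \<noteq> 0 \<and>
     (\<exists>c d. c \<noteq> 0 \<and> d \<noteq> 0 \<and> smul c x = smul d y)}"

definition rays ::
  "('a::comm_semiring_1 \<Rightarrow> 'v::comm_monoid_add \<Rightarrow> 'v) \<Rightarrow> 'v set set" where
  "rays smul = (UNIV - {0}) // ray_rel smul"

fun f_w :: "('v \<Rightarrow> 'a::bipotent_semifield) \<Rightarrow> ('v \<Rightarrow> 'v \<Rightarrow> 'a) \<Rightarrow> 'v \<Rightarrow> 'v \<Rightarrow> 'v
    \<Rightarrow> 'a with_infty \<Rightarrow> 'a" where
  "f_w q b \<epsilon>\<^sub>1 \<epsilon>\<^sub>2 w (Fin t) =
     ((b \<epsilon>\<^sub>1 w)\<^sup>2 + t\<^sup>2 * (b \<epsilon>\<^sub>2 w)\<^sup>2) / ((q \<epsilon>\<^sub>1 + b \<epsilon>\<^sub>1 \<epsilon>\<^sub>2 * t + q \<epsilon>\<^sub>2 * t\<^sup>2) * q w)"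
| "f_w q b \<epsilon>\<^sub>1 \<epsilon>\<^sub>2 w Infty = (b \<epsilon>\<^sub>2 w)\<^sup>2 / (q \<epsilon>\<^sub>2 * q w)"

end

theory Submission
  imports Defs
begin

text \<open>
  Since addition is the maximum and squaring is additive, \<open>f_w\<close> is a quotient
  \<open>max (a\<^sup>2) (c\<^sup>2 \<lambda>\<^sup>2) / (max \<alpha>\<^sub>1 (\<alpha>\<^sub>1\<^sub>2 \<lambda>) (\<alpha>\<^sub>2 \<lambda>\<^sup>2) \<cdot> k)\<close> with \<open>a = b \<epsilon>\<^sub>1 w\<close>, \<open>c = b \<epsilon>\<^sub>2 w\<close>
  and \<open>k = q w\<close>.  The numerator changes from its constant to its quadratic term at \<open>p = a / c\<close>.
  If \<open>\<alpha>\<^sub>1 \<alpha>\<^sub>2 \<le> \<alpha>\<^sub>1\<^sub>2\<^sup>2\<close> and \<open>\<alpha>\<^sub>1\<^sub>2 \<noteq> 0\<close>, the denominator passes through the degrees 0, 1, 2, with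
  changes at \<open>\<alpha>\<^sub>1 / \<alpha>\<^sub>1\<^sub>2 \<le> \<alpha>\<^sub>1\<^sub>2 / \<alpha>\<^sub>2\<close>.
  To the left of all these thresholds both degrees are 0, to the right of all of them both are 2,
  so \<open>f_w\<close> is constant there.  In between, the two degrees always differ: the
  numerator can have degree 0 only left of \<open>p\<close> and degree 2 only right of it, whereas the
  denominator has degree 0 only left of \<open>\<alpha>\<^sub>1 / \<alpha>\<^sub>1\<^sub>2\<close> and degree 2 only right of \<open>\<alpha>\<^sub>1\<^sub>2 / \<alpha>\<^sub>2\<close>, and
  the numerator never has degree 1.  Hence each piece there is a monomial of nonzero degree, which
  is injective (\<open>chain_between\<close>, \<open>chain_not_constant_on_subinterval\<close>).

  The case \<open>\<alpha>\<^sub>1\<^sub>2\<^sup>2 \<le> \<alpha>\<^sub>1 \<alpha>\<^sub>2\<close> is an instance of the same analysis.  A linear term with such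
  a coefficient never exceeds both other terms (\<open>linear_term_absorbed\<close>), so \<open>\<alpha>\<^sub>1\<^sub>2\<close> may be
  replaced by \<open>\<surd>(\<alpha>\<^sub>1 \<alpha>\<^sub>2)\<close>; both thresholds of the denominator then equal \<open>\<surd>(\<alpha>\<^sub>1 / \<alpha>\<^sub>2)\<close>.
\<close>

section \<open>Arithmetic in a bipotent semifield\<close>

lemma zero_le_bipotent: "0 \<le> (x::'a::bipotent_semifield)"
  using add_eq_max[of 0 x] by (simp add: max_def split: if_splits)

lemma inverse_mult_self: "x \<noteq> 0 \<Longrightarrow> inverse x * (x::'a::bipotent_semifield) = 1"
  by (simp add: right_inverse_nonzero mult.commute)

instance bipotent_semifield \<subseteq> semiring_1_no_zero_divisors
proof
  fix a b :: 'a
  assume "a \<noteq> 0" "b \<noteq> 0"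
  then have "a * b * (inverse a * inverse b) = 1"
    by (metis right_inverse_nonzero mult.assoc mult.left_commute mult.right_neutral)
  then show "a * b \<noteq> 0" by auto
qed

instance bipotent_semifield \<subseteq> semiring_no_zero_divisors_cancel
proof
  have left: "c * a = c * b \<longleftrightarrow> c = 0 \<or> a = b" for a b c :: 'a
    by (metis inverse_mult_self mult.assoc mult.left_neutral mult_zero_left)
  then show "c * a = c * b \<longleftrightarrow> c = 0 \<or> a = b" for a b c :: 'a .
  then show "a * c = b * c \<longleftrightarrow> c = 0 \<or> a = b" for a b c :: 'a
    by (metis mult.commute)
qed

text \<open>Since addition is the maximum, monotonicity of multiplication is the distributive law.\<close>

lemma mult_left_mono_bipotent:
  fixes a x y :: "'a::bipotent_semifield"
  assumes "x \<le> y"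
  shows "a * x \<le> a * y"
proof -
  have "max (a * x) (a * y) = a * (x + y)"
    by (simp add: distrib_left flip: add_eq_max)
  also have "x + y = y" using assms by (simp add: add_eq_max)
  finally show ?thesis by (metis max.cobounded1)
qed

lemma mult_le_cancel_bipotent:
  fixes a x y :: "'a::bipotent_semifield"
  assumes "a \<noteq> 0"
  shows "a * x \<le> a * y \<longleftrightarrow> x \<le> y"
  using assms mult_left_mono_bipotent[of x y a] mult_left_mono_bipotent[of y x a]
  by (metis linear mult_cancel_left order_antisym)

lemma mult_mono_bipotent:
  fixes a b x y :: "'a::bipotent_semifield"
  assumes "a \<le> b" "x \<le> y"
  shows "a * x \<le> b * y"
  using mult_left_mono_bipotent[OF assms(2), of a] mult_left_mono_bipotent[OF assms(1), of y]
  by (simp add: mult.commute)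

lemma power_strict_mono_bipotent:
  fixes x y :: "'a::bipotent_semifield"
  assumes "x < y" "0 < n"
  shows "x ^ n < y ^ n"
  using assms(2)
proof (induction n rule: nat_induct_non_zero)
  case 1
  show ?case using assms(1) by simp
next
  case (Suc n)
  have y: "y \<noteq> 0" using assms(1) zero_le_bipotent[of x] by auto
  have "x * x ^ n \<le> y * x ^ n"
    using assms(1) by (intro mult_mono_bipotent) auto
  also have "y * x ^ n < y * y ^ n"
    using Suc.IH y by (simp add: mult_le_cancel_bipotent flip: not_le)
  finally show ?case by simp
qed

lemma power2_le_iff_bipotent:
  fixes x y :: "'a::bipotent_semifield"
  shows "x\<^sup>2 \<le> y\<^sup>2 \<longleftrightarrow> x \<le> y"
  using power_strict_mono_bipotent[of y x 2] mult_mono_bipotent[of x y x y]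
  by (auto simp: power2_eq_square not_le[symmetric])

lemma inverse_neq_zero_bipotent: "x \<noteq> 0 \<Longrightarrow> inverse (x::'a::bipotent_semifield) \<noteq> 0"
  using inverse_mult_self[of x] by auto

lemma divide_eq_zero_bipotent: "y \<noteq> 0 \<Longrightarrow> x / y = 0 \<longleftrightarrow> (x::'a::bipotent_semifield) = 0"
  by (simp add: divide_eq_times_inverse inverse_neq_zero_bipotent)

lemma times_divide_bipotent: "y \<noteq> 0 \<Longrightarrow> y * (x / y) = (x::'a::bipotent_semifield)"
  by (metis divide_eq_times_inverse mult.left_commute mult.right_neutral right_inverse_nonzero)

lemma divide_eq_iff_bipotent:
  fixes x y z :: "'a::bipotent_semifield"
  assumes "y \<noteq> 0"
  shows "x / y = z \<longleftrightarrow> x = y * z"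
  using assms by (metis mult_cancel_left times_divide_bipotent)

lemma divide_le_iff_bipotent:
  fixes x y z :: "'a::bipotent_semifield"
  assumes "y \<noteq> 0"
  shows "x / y \<le> z \<longleftrightarrow> x \<le> y * z"
  using assms by (metis mult_le_cancel_bipotent times_divide_bipotent)

lemma le_divide_iff_bipotent:
  fixes x y z :: "'a::bipotent_semifield"
  assumes "y \<noteq> 0"
  shows "z \<le> x / y \<longleftrightarrow> y * z \<le> x"
  using assms by (metis mult_le_cancel_bipotent times_divide_bipotent)


section \<open>Monomials on the extended range\<close>

lemma Fin_divide: "y \<noteq> 0 \<Longrightarrow> Fin x / Fin y = Fin (x / (y::'a::bipotent_semifield))"
  by (simp add: divide_with_infty_def divide_eq_times_inverse)

lemma Fin_divide_zero: "x \<noteq> 0 \<Longrightarrow> Fin x / Fin 0 = (Infty::'a::bipotent_semifield with_infty)"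
  by (simp add: divide_with_infty_def)

lemma zero_le_with_infty: "0 \<le> (t::'a::bipotent_semifield with_infty)"
  by (cases t) (auto simp: zero_with_infty_def zero_le_bipotent)

text \<open>
  Cross-multiplied, a comparison with the quotient \<open>a / 0 = \<infinity>\<close> obeys the same rule as one with a
  finite quotient.
\<close>

lemma Fin_le_quotient_iff:
  fixes a c x :: "'a::bipotent_semifield"
  assumes "a \<noteq> 0 \<or> c \<noteq> 0"
  shows "Fin x \<le> Fin a / Fin c \<longleftrightarrow> c * x \<le> a"
  using assms
  by (cases "c = 0") (auto simp: Fin_divide Fin_divide_zero le_divide_iff_bipotent zero_le_bipotent)

lemma quotient_le_Fin_iff:
  fixes a c x :: "'a::bipotent_semifield"
  assumes "a \<noteq> 0 \<or> c \<noteq> 0"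
  shows "Fin a / Fin c \<le> Fin x \<longleftrightarrow> a \<le> c * x"
  using assms zero_le_bipotent[of a]
  by (cases "c = 0") (auto simp: Fin_divide Fin_divide_zero divide_le_iff_bipotent)

lemma power_Fin: "Fin x ^ n = Fin (x ^ n)"
  for x :: "'a::bipotent_semifield"
  by (induction n) (auto simp: one_with_infty_def)

lemma power_Infty: "0 < n \<Longrightarrow> (Infty::'a::bipotent_semifield with_infty) ^ n = Infty"
  by (induction n rule: nat_induct_non_zero) (auto simp: one_with_infty_def)

lemma power_with_infty_inject:
  fixes s t :: "'a::bipotent_semifield with_infty"
  assumes "0 < n" "s ^ n = t ^ n"
  shows "s = t"
proof (cases s; cases t)
  fix x y assume st: "s = Fin x" "t = Fin y"
  then have "x ^ n = y ^ n" using assms(2) by (simp add: power_Fin)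
  then have "x = y"
    using power_strict_mono_bipotent[OF _ assms(1)] by (metis linorder_less_linear order_less_irrefl)
  then show ?thesis using st by simp
qed (use assms in \<open>auto simp: power_Fin power_Infty\<close>)

lemma inverse_with_infty_inverse: "inverse (inverse t) = (t::'a::bipotent_semifield with_infty)"
proof (cases t)
  case (Fin x)
  have "inverse (inverse x) = x" if "x \<noteq> 0"
    using that
    by (metis inverse_mult_self inverse_neq_zero_bipotent mult.commute mult_cancel_left)
  with Fin show ?thesis by (auto simp: inverse_neq_zero_bipotent)
qed simp

lemma power_int_with_infty_inject:
  fixes s t :: "'a::bipotent_semifield with_infty"
  assumes "j \<noteq> 0" "s powi j = t powi j"
  shows "s = t"
proof (cases "j > 0")
  case True
  then show ?thesis
    using assms power_with_infty_inject[of "nat j" s t] by (simp add: power_int_def)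
next
  case False
  then have "inverse s = inverse t"
    using assms power_with_infty_inject[of "nat (- j)" "inverse s" "inverse t"]
    by (simp add: power_int_def split: if_splits)
  then show ?thesis by (metis inverse_with_infty_inverse)
qed

lemma Fin_times_inject:
  fixes s t :: "'a::bipotent_semifield with_infty"
  shows "\<gamma> \<noteq> 0 \<Longrightarrow> Fin \<gamma> * s = Fin \<gamma> * t \<Longrightarrow> s = t"
  by (cases s; cases t) auto

text \<open>
  The predicate below combines the two assertions about the middle interval: it describes a chain
  of monomial pieces, all of nonzero degree.  The chain without pieces covers an interval that degenerates to a point.
\<close>

inductive nonconstant_monomial_chain ::
  "('a::bipotent_semifield with_infty \<Rightarrow> 'a with_infty) \<Rightarrow> 'a with_infty \<Rightarrow> 'a with_infty \<Rightarrow> bool"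
  for f where
  empty: "nonconstant_monomial_chain f u u"
| piece: "\<lbrakk>u < v; \<gamma> \<noteq> 0; j \<noteq> 0; \<And>t. t \<in> {u..v} \<Longrightarrow> f t = Fin \<gamma> * t powi j;
    nonconstant_monomial_chain f v w\<rbrakk> \<Longrightarrow> nonconstant_monomial_chain f u w"

lemma single_piece_chain:
  assumes "u \<le> v" "\<gamma> \<noteq> 0" "j \<noteq> 0" "\<And>t. u \<le> t \<Longrightarrow> t \<le> v \<Longrightarrow> f t = Fin \<gamma> * t powi j"
  shows "nonconstant_monomial_chain f u v"
proof (cases "u = v")
  case True
  then show ?thesis by (simp add: nonconstant_monomial_chain.empty)
next
  case False
  show ?thesis
    by (rule nonconstant_monomial_chain.piece[where v = v and \<gamma> = \<gamma> and j = j])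
      (use assms False in \<open>auto intro: nonconstant_monomial_chain.empty\<close>)
qed

lemma nonconstant_monomial_chain_trans:
  assumes "nonconstant_monomial_chain f u v" "nonconstant_monomial_chain f v w"
  shows "nonconstant_monomial_chain f u w"
  using assms
  by (induction rule: nonconstant_monomial_chain.induct)
    (auto intro: nonconstant_monomial_chain.piece)

lemma piecewise_monomial_if_chain:
  "nonconstant_monomial_chain f u v \<Longrightarrow> piecewise_monomial f u v"
proof (induction rule: nonconstant_monomial_chain.induct)
  case (empty u)
  show ?case unfolding piecewise_monomial_def
    by (intro exI[of _ 0] exI[of _ "\<lambda>_. u"]) simp
next
  case (piece u v \<gamma> j w)
  have m: "monomial_on f {u..v}" unfolding monomial_on_def using piece by blast
  obtain r \<beta> where \<beta>: "\<beta> 0 = v" "\<beta> r = w"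
    "\<forall>s<r. \<beta> s < \<beta> (Suc s) \<and> monomial_on f {\<beta> s..\<beta> (Suc s)}"
    using piece.IH unfolding piecewise_monomial_def by auto
  define \<beta>' where "\<beta>' = case_nat u \<beta>"
  have "\<forall>s<Suc r. \<beta>' s < \<beta>' (Suc s) \<and> monomial_on f {\<beta>' s..\<beta>' (Suc s)}"
    using \<beta> m piece.hyps(1) by (auto simp: \<beta>'_def split: nat.split)
  with \<beta> show ?case unfolding piecewise_monomial_def
    by (intro exI[of _ "Suc r"] exI[of _ \<beta>']) (auto simp: \<beta>'_def)
qed

text \<open>
  Two points of one piece have different values because a monomial of nonzero degree is
  injective.  If \<open>x\<close> and \<open>y\<close> lie in different pieces, the right end of the piece of \<open>x\<close> takes the
  role of \<open>y\<close>: it lies in the subinterval even if the order of the semifield has gaps.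
\<close>

lemma chain_not_locally_constant:
  assumes "nonconstant_monomial_chain f u w" "u \<le> x" "x < y" "y \<le> w"
  shows "\<exists>z\<in>{x..y}. f z \<noteq> f x"
  using assms
proof (induction arbitrary: x y rule: nonconstant_monomial_chain.induct)
  case (empty u)
  then show ?case by auto
next
  case (piece u v \<gamma> j w)
  show ?case
  proof (cases "x < v")
    case True
    define z where "z = min y v"
    have z: "z \<in> {x..y}" "z \<in> {u..v}" "x \<in> {u..v}" "z \<noteq> x"
      using piece.prems True by (auto simp: z_def min_def)
    have "f z \<noteq> f x"
    proof
      assume "f z = f x"
      then have "Fin \<gamma> * z powi j = Fin \<gamma> * x powi j"
        using piece.hyps(4) z by metis
      then have "z = x"
        using piece.hyps(2,3) Fin_times_inject power_int_with_infty_inject by blast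
      with z show False by simp
    qed
    with z show ?thesis by blast
  next
    case False
    then show ?thesis using piece.IH[of x y] piece.prems by auto
  qed
qed

lemma chain_not_constant_on_subinterval:
  assumes "nonconstant_monomial_chain (\<lambda>t. Fin (f t)) u v" "I \<subseteq> {u..v}" "order_convex I"
    and "\<exists>x\<in>I. \<exists>y\<in>I. x \<noteq> y"
  shows "\<not> f constant_on I"
proof -
  from assms(4) obtain x y where xy: "x \<in> I" "y \<in> I" "x < y"
    by (metis linorder_less_linear)
  then have "u \<le> x" "y \<le> v" using assms(2) by auto
  with xy assms(1) obtain z where "z \<in> {x..y}" "f z \<noteq> f x"
    using chain_not_locally_constant by blast
  moreover have "{x..y} \<subseteq> I" using assms(3) xy by (auto simp: order_convex_def)
  ultimately show ?thesis using xy unfolding constant_on_def by (metis subsetD)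
qed


section \<open>The profile of the ratio along a pair of rays\<close>

text \<open>
  The function \<open>f_w\<close> with its six values of \<open>q\<close> and \<open>b\<close> as free parameters, so that the linear
  coefficient \<open>\<delta>\<close> can be changed independently of the vectors.
\<close>

fun cs_profile :: "'a \<Rightarrow> 'a \<Rightarrow> 'a \<Rightarrow> 'a \<Rightarrow> 'a \<Rightarrow> 'a \<Rightarrow> 'a with_infty \<Rightarrow> 'a::bipotent_semifield" where
  "cs_profile a c \<alpha> \<delta> \<beta> k (Fin x) = (a\<^sup>2 + x\<^sup>2 * c\<^sup>2) / ((\<alpha> + \<delta> * x + \<beta> * x\<^sup>2) * k)"
| "cs_profile a c \<alpha> \<delta> \<beta> k Infty = c\<^sup>2 / (\<beta> * k)"

lemma f_w_eq_cs_profile: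
  "f_w q b \<epsilon>\<^sub>1 \<epsilon>\<^sub>2 w = cs_profile (b \<epsilon>\<^sub>1 w) (b \<epsilon>\<^sub>2 w) (q \<epsilon>\<^sub>1) (b \<epsilon>\<^sub>1 \<epsilon>\<^sub>2) (q \<epsilon>\<^sub>2) (q w)"
proof
  fix t show "f_w q b \<epsilon>\<^sub>1 \<epsilon>\<^sub>2 w t
      = cs_profile (b \<epsilon>\<^sub>1 w) (b \<epsilon>\<^sub>2 w) (q \<epsilon>\<^sub>1) (b \<epsilon>\<^sub>1 \<epsilon>\<^sub>2) (q \<epsilon>\<^sub>2) (q w) t"
    by (cases t) auto
qed

text \<open>
  The geometric mean of \<open>\<alpha>\<close> and \<open>\<beta> x\<^sup>2\<close> is at most their maximum, so a linear coefficient \<open>d\<close>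
  with \<open>d\<^sup>2 \<le> \<alpha> \<beta>\<close> never shows.
\<close>

lemma linear_term_absorbed:
  fixes \<alpha> \<beta> d x :: "'a::bipotent_semifield"
  assumes "d\<^sup>2 \<le> \<alpha> * \<beta>"
  shows "\<alpha> + d * x + \<beta> * x\<^sup>2 = \<alpha> + \<beta> * x\<^sup>2"
proof -
  let ?m = "max \<alpha> (\<beta> * x\<^sup>2)"
  have "(d * x)\<^sup>2 \<le> \<alpha> * (\<beta> * x\<^sup>2)"
    using mult_mono_bipotent[OF assms order_refl, of "x\<^sup>2"]
    by (simp add: power_mult_distrib mult.assoc)
  also have "\<dots> \<le> ?m\<^sup>2"
    unfolding power2_eq_square[of ?m] by (intro mult_mono_bipotent) auto
  finally have "d * x \<le> ?m" by (simp only: power2_le_iff_bipotent)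
  then show ?thesis by (auto simp: add_eq_max max_def)
qed

lemma cs_profile_absorb:
  assumes "d\<^sup>2 \<le> \<alpha> * \<beta>" "d'\<^sup>2 \<le> \<alpha> * \<beta>"
  shows "cs_profile a c \<alpha> d \<beta> k = cs_profile a c \<alpha> d' \<beta> k"
proof
  fix t show "cs_profile a c \<alpha> d \<beta> k t = cs_profile a c \<alpha> d' \<beta> k t"
    by (cases t) (simp_all add: linear_term_absorbed assms)
qed

text \<open>
  The hypothesis on \<open>\<delta>\<close> says that the thresholds satisfy \<open>\<alpha> / \<delta> \<le> \<delta> / \<beta>\<close>; each of
  the three terms of the denominator then dominates on one of the intervals that they cut out.
  Equality is admitted since the case of a small linear coefficient is reduced to it.
\<close>

locale dominant_profile =
  fixes a c \<alpha> \<delta> \<beta> k :: "'a::bipotent_semifield"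
  assumes numerator_nonzero: "a \<noteq> 0 \<or> c \<noteq> 0"
    and nonzero: "\<alpha> \<noteq> 0" "\<beta> \<noteq> 0" "\<delta> \<noteq> 0" "k \<noteq> 0"
    and discriminant: "\<alpha> * \<beta> \<le> \<delta>\<^sup>2"
begin

abbreviation "g \<equiv> cs_profile a c \<alpha> \<delta> \<beta> k"
abbreviation "p \<equiv> Fin a / Fin c"
abbreviation "lo \<equiv> Fin \<alpha> / Fin \<delta>"
abbreviation "hi \<equiv> Fin \<delta> / Fin \<beta>"

lemma lo_le_hi: "lo \<le> hi"
proof -
  have "\<beta> * \<alpha> \<le> \<delta> * \<delta>" using discriminant by (simp add: power2_eq_square mult.commute)
  then have "\<delta> * (\<beta> * (\<alpha> / \<delta>)) \<le> \<delta> * \<delta>"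
    using nonzero by (simp add: times_divide_bipotent mult.left_commute)
  then show ?thesis
    using nonzero by (simp add: Fin_divide le_divide_iff_bipotent mult_le_cancel_bipotent)
qed

lemma numerator_left:
  assumes "Fin x \<le> p"
  shows "a\<^sup>2 + x\<^sup>2 * c\<^sup>2 = a\<^sup>2"
proof -
  have "(c * x)\<^sup>2 \<le> a\<^sup>2"
    using assms numerator_nonzero by (simp add: Fin_le_quotient_iff power2_le_iff_bipotent)
  then show ?thesis by (simp add: add_eq_max max_def power_mult_distrib mult.commute)
qed

lemma numerator_right:
  assumes "p \<le> Fin x"
  shows "a\<^sup>2 + x\<^sup>2 * c\<^sup>2 = x\<^sup>2 * c\<^sup>2"
proof -
  have "a\<^sup>2 \<le> (c * x)\<^sup>2"
    using assms numerator_nonzero by (simp add: quotient_le_Fin_iff power2_le_iff_bipotent)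
  then show ?thesis by (simp add: add_eq_max max_def power_mult_distrib mult.commute)
qed

lemma linear_le_constant_iff: "\<delta> * x \<le> \<alpha> \<longleftrightarrow> Fin x \<le> lo"
  using nonzero by (simp add: Fin_le_quotient_iff)

lemma constant_le_linear_iff: "\<alpha> \<le> \<delta> * x \<longleftrightarrow> lo \<le> Fin x"
  using nonzero by (simp add: quotient_le_Fin_iff)

lemma square_le_linear: "Fin x \<le> hi \<Longrightarrow> \<beta> * x\<^sup>2 \<le> \<delta> * x"
  using mult_mono_bipotent[of "\<beta> * x" \<delta> x x] nonzero
  by (simp add: Fin_le_quotient_iff power2_eq_square mult.assoc)

lemma linear_le_square: "hi \<le> Fin x \<Longrightarrow> \<delta> * x \<le> \<beta> * x\<^sup>2"
  using mult_mono_bipotent[of \<delta> "\<beta> * x" x x] nonzero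
  by (simp add: quotient_le_Fin_iff power2_eq_square mult.assoc)

lemma denominator_left:
  assumes "Fin x \<le> lo"
  shows "\<alpha> + \<delta> * x + \<beta> * x\<^sup>2 = \<alpha>"
proof -
  have "\<delta> * x \<le> \<alpha>" using assms linear_le_constant_iff by blast
  moreover have "\<beta> * x\<^sup>2 \<le> \<delta> * x" using assms lo_le_hi by (intro square_le_linear) (rule order_trans)
  ultimately show ?thesis by (simp add: add_eq_max max_absorb1)
qed

lemma denominator_middle:
  assumes "lo \<le> Fin x" "Fin x \<le> hi"
  shows "\<alpha> + \<delta> * x + \<beta> * x\<^sup>2 = \<delta> * x"
  using assms constant_le_linear_iff[of x] square_le_linear[of x]
  by (simp add: add_eq_max max_absorb1 max_absorb2)

lemma denominator_right:
  assumes "hi \<le> Fin x"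
  shows "\<alpha> + \<delta> * x + \<beta> * x\<^sup>2 = \<beta> * x\<^sup>2"
proof -
  have "\<alpha> \<le> \<delta> * x" using order_trans[OF lo_le_hi assms] constant_le_linear_iff by blast
  moreover have "\<delta> * x \<le> \<beta> * x\<^sup>2" using assms by (rule linear_le_square)
  ultimately show ?thesis by (simp add: add_eq_max max_absorb2)
qed

lemma above_lo_nonzero: "lo \<le> Fin x \<Longrightarrow> x \<noteq> 0"
  using constant_le_linear_iff[of x] nonzero zero_le_bipotent[of \<alpha>] by auto

lemma above_hi_nonzero: "hi \<le> Fin x \<Longrightarrow> x \<noteq> 0"
  using order_trans[OF lo_le_hi] by (rule above_lo_nonzero)

text \<open>
  The coefficients of the pieces below have to be nonzero: \<open>p\<close> is positive only if \<open>a \<noteq> 0\<close>, and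
  finite only if \<open>c \<noteq> 0\<close>.
\<close>

lemma lo_le_p_imp: "lo \<le> p \<Longrightarrow> a \<noteq> 0"
  using above_lo_nonzero[of 0] numerator_nonzero
  by (cases "c = 0") (auto simp: Fin_divide divide_eq_times_inverse)

lemma p_le_Fin_imp: "p \<le> Fin x \<Longrightarrow> c \<noteq> 0"
  using numerator_nonzero by (auto simp: Fin_divide_zero)

lemma profile_left_constant:
  assumes "t \<le> min p lo"
  shows "g t = a\<^sup>2 / (\<alpha> * k)"
proof (cases t)
  case (Fin x)
  then show ?thesis using assms by (simp add: numerator_left denominator_left)
next
  case Infty
  then show ?thesis using assms nonzero by (simp add: Fin_divide)
qed

lemma profile_right_constant:
  assumes "max p hi \<le> t"
  shows "g t = c\<^sup>2 / (\<beta> * k)"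
proof (cases t)
  case (Fin x)
  have x: "x \<noteq> 0" using assms Fin above_hi_nonzero by simp
  have "\<beta> * x\<^sup>2 * k * (c\<^sup>2 / (\<beta> * k)) = x\<^sup>2 * (\<beta> * k * (c\<^sup>2 / (\<beta> * k)))"
    by (simp only: mult_ac)
  also have "\<dots> = x\<^sup>2 * c\<^sup>2" using nonzero by (simp add: times_divide_bipotent)
  finally have "(x\<^sup>2 * c\<^sup>2) / (\<beta> * x\<^sup>2 * k) = c\<^sup>2 / (\<beta> * k)"
    using x nonzero by (simp add: divide_eq_iff_bipotent)
  then show ?thesis
    using assms Fin by (simp add: numerator_right denominator_right)
qed simp

text \<open>
  The following four lemmas treat the regions in which numerator and denominator have different
  degrees; the degree of the quotient is the difference.
\<close>

lemma profile_degree_two: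
  assumes "p \<le> t" "t \<le> lo"
  shows "Fin (g t) = Fin (c\<^sup>2 / (\<alpha> * k)) * t powi 2"
proof (cases t)
  case (Fin x)
  then show ?thesis using assms
    by (simp only: Fin cs_profile.simps numerator_right denominator_left)
      (simp add: power_int_def power_Fin divide_eq_times_inverse mult_ac)
next
  case Infty
  then show ?thesis using assms nonzero by (simp add: Fin_divide)
qed

lemma profile_degree_one:
  assumes "p \<le> t" "lo \<le> t" "t \<le> hi"
  shows "Fin (g t) = Fin (c\<^sup>2 / (\<delta> * k)) * t powi 1"
proof (cases t)
  case (Fin x)
  have x: "x \<noteq> 0" using assms Fin above_lo_nonzero by simp
  have "\<delta> * x * k * (c\<^sup>2 / (\<delta> * k) * x) = x\<^sup>2 * (\<delta> * k * (c\<^sup>2 / (\<delta> * k)))"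
    by (simp only: power2_eq_square[of x] mult_ac)
  also have "\<dots> = x\<^sup>2 * c\<^sup>2" using nonzero by (simp add: times_divide_bipotent)
  finally have "(x\<^sup>2 * c\<^sup>2) / (\<delta> * x * k) = c\<^sup>2 / (\<delta> * k) * x"
    using x nonzero by (simp add: divide_eq_iff_bipotent)
  then show ?thesis using assms Fin
    by (simp add: numerator_right denominator_middle power_int_def one_with_infty_def)
next
  case Infty
  then show ?thesis using assms nonzero by (simp add: Fin_divide)
qed

lemma profile_degree_minus_one:
  assumes "t \<le> p" "lo \<le> t" "t \<le> hi"
  shows "Fin (g t) = Fin (a\<^sup>2 / (\<delta> * k)) * t powi (- 1)"
proof (cases t)
  case (Fin x)
  have x: "x \<noteq> 0" using assms Fin above_lo_nonzero by simp
  have "\<delta> * x * k * (a\<^sup>2 / (\<delta> * k) * inverse x) = (\<delta> * k * (a\<^sup>2 / (\<delta> * k))) * (x * inverse x)"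
    by (simp only: mult_ac)
  also have "\<dots> = a\<^sup>2"
    using nonzero x by (simp add: times_divide_bipotent right_inverse_nonzero)
  finally have "a\<^sup>2 / (\<delta> * x * k) = a\<^sup>2 / (\<delta> * k) * inverse x"
    using x nonzero by (simp add: divide_eq_iff_bipotent)
  then show ?thesis using assms Fin x
    by (simp add: numerator_left denominator_middle power_int_def one_with_infty_def)
next
  case Infty
  then show ?thesis using assms nonzero by (simp add: Fin_divide)
qed

text \<open>
  Here the value at \<open>\<infinity>\<close> matters: it occurs exactly if \<open>c = 0\<close>, and then both sides vanish.
\<close>

lemma profile_degree_minus_two:
  assumes "t \<le> p" "hi \<le> t"
  shows "Fin (g t) = Fin (a\<^sup>2 / (\<beta> * k)) * t powi (- 2)"
proof (cases t)
  case (Fin x)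
  have x: "x \<noteq> 0" using assms Fin above_hi_nonzero by simp
  have "\<beta> * x\<^sup>2 * k * (a\<^sup>2 / (\<beta> * k) * (inverse x)\<^sup>2)
      = (\<beta> * k * (a\<^sup>2 / (\<beta> * k))) * (x * inverse x)\<^sup>2"
    by (simp only: mult_ac power_mult_distrib)
  also have "\<dots> = a\<^sup>2"
    using nonzero x by (simp add: times_divide_bipotent right_inverse_nonzero)
  finally have "a\<^sup>2 / (\<beta> * x\<^sup>2 * k) = a\<^sup>2 / (\<beta> * k) * (inverse x)\<^sup>2"
    using x nonzero by (simp add: divide_eq_iff_bipotent)
  then show ?thesis using assms Fin x
    by (simp add: numerator_left denominator_right power_int_def power_Fin)
next
  case Infty
  then have "c = 0" using assms by (cases "c = 0") (auto simp: Fin_divide)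
  then show ?thesis using Infty nonzero
    by (simp add: power_int_def power_Fin divide_eq_times_inverse)
qed

text \<open>On either side, numerator and denominator have the same degree, which cancels.\<close>

lemma constant_on_left: "g constant_on {0..min p lo}"
  using profile_left_constant by (auto simp: constant_on_def)

lemma constant_on_right: "g constant_on {max p hi..Infty}"
  using profile_right_constant by (auto simp: constant_on_def)

text \<open>
  The position of \<open>p\<close> relative to the two thresholds of the denominator decides which two degrees
  occur: 2 and 1, or -1 and 1, or -1 and -2.
\<close>

lemma chain_between: "nonconstant_monomial_chain (\<lambda>t. Fin (g t)) (min p lo) (max p hi)"
proof -
  let ?chain = "nonconstant_monomial_chain (\<lambda>t. Fin (g t))"
  have fin: "lo = Fin (\<alpha> / \<delta>)" "hi = Fin (\<delta> / \<beta>)" using nonzero by (simp_all add: Fin_divide)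
  consider "p \<le> lo" | "lo \<le> p" "p \<le> hi" | "hi \<le> p" by (meson linear)
  then show ?thesis
  proof cases
    case 1
    then have c: "c \<noteq> 0" using p_le_Fin_imp fin by simp
    have "?chain p lo"
      by (rule single_piece_chain[where \<gamma> = "c\<^sup>2 / (\<alpha> * k)" and j = 2])
        (use 1 c nonzero profile_degree_two in \<open>simp_all add: divide_eq_zero_bipotent\<close>)
    moreover have "?chain lo hi"
      by (rule single_piece_chain[where \<gamma> = "c\<^sup>2 / (\<delta> * k)" and j = 1])
        (use 1 c nonzero lo_le_hi profile_degree_one in
          \<open>simp_all add: divide_eq_zero_bipotent order_trans[of p lo]\<close>)
    ultimately have "?chain p hi" by (rule nonconstant_monomial_chain_trans)
    moreover have "min p lo = p" "max p hi = hi"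
      using 1 order_trans[OF 1 lo_le_hi] by (auto intro: min_absorb1 max_absorb2)
    ultimately show ?thesis by simp
  next
    case 2
    then have a: "a \<noteq> 0" using lo_le_p_imp by simp
    from 2 have c: "c \<noteq> 0" using p_le_Fin_imp fin by simp
    have "?chain lo p"
      by (rule single_piece_chain[where \<gamma> = "a\<^sup>2 / (\<delta> * k)" and j = "- 1"])
        (use 2 a nonzero profile_degree_minus_one in
          \<open>simp_all add: divide_eq_zero_bipotent order_trans[of _ p hi]\<close>)
    moreover have "?chain p hi"
      by (rule single_piece_chain[where \<gamma> = "c\<^sup>2 / (\<delta> * k)" and j = 1])
        (use 2 c nonzero profile_degree_one in
          \<open>simp_all add: divide_eq_zero_bipotent order_trans[of lo p]\<close>)
    ultimately have "?chain lo hi" by (rule nonconstant_monomial_chain_trans)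
    then show ?thesis using 2 by (simp add: min_absorb2 max_absorb2)
  next
    case 3
    have lo_p: "lo \<le> p" using 3 lo_le_hi by (rule order_trans[rotated])
    then have a: "a \<noteq> 0" by (rule lo_le_p_imp)
    have "?chain lo hi"
      by (rule single_piece_chain[where \<gamma> = "a\<^sup>2 / (\<delta> * k)" and j = "- 1"])
        (use 3 a nonzero lo_le_hi profile_degree_minus_one in
          \<open>simp_all add: divide_eq_zero_bipotent order_trans[of _ hi p]\<close>)
    moreover have "?chain hi p"
      by (rule single_piece_chain[where \<gamma> = "a\<^sup>2 / (\<beta> * k)" and j = "- 2"])
        (use 3 a nonzero profile_degree_minus_two in \<open>simp_all add: divide_eq_zero_bipotent\<close>)
    ultimately have "?chain lo p" by (rule nonconstant_monomial_chain_trans)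
    then show ?thesis using 3 lo_p by (simp add: min_absorb2 max_absorb1)
  qed
qed

end


section \<open>Nonvanishing of the coefficients\<close>

lemma nonzero_if_in_ray: "Y \<in> rays smul \<Longrightarrow> x \<in> Y \<Longrightarrow> x \<noteq> 0"
  by (auto simp: rays_def ray_rel_def quotient_def)

lemma (in quadratic_module) bilinear_zero_right: "b x 0 = 0"
  using bilinear_scale_left[of 0 0 x] by (simp add: scale_zero_left bilinear_sym)


section \<open>The behaviour of the ratio on the ray interval\<close>


theorem proposition1p5:
  fixes smul :: "'a::square_closed_bipotent_semifield \<Rightarrow> 'v::comm_monoid_add \<Rightarrow> 'v"
    and q :: "'v \<Rightarrow> 'a" and b :: "'v \<Rightarrow> 'v \<Rightarrow> 'a"
    and Y\<^sub>1 Y\<^sub>2 :: "'v set" and \<epsilon>\<^sub>1 \<epsilon>\<^sub>2 w :: 'v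
    and \<alpha>\<^sub>1 \<alpha>\<^sub>2 \<alpha>\<^sub>1\<^sub>2 :: 'a and f :: "'a with_infty \<Rightarrow> 'a"
  assumes "quadratic_module smul q b" and "anisotropic q"
    and "Y\<^sub>1 \<in> rays smul" and "Y\<^sub>2 \<in> rays smul" and "Y\<^sub>1 \<noteq> Y\<^sub>2"
    and "\<epsilon>\<^sub>1 \<in> Y\<^sub>1" and "\<epsilon>\<^sub>2 \<in> Y\<^sub>2"
    and "\<alpha>\<^sub>1 = q \<epsilon>\<^sub>1" and "\<alpha>\<^sub>2 = q \<epsilon>\<^sub>2" and "\<alpha>\<^sub>1\<^sub>2 = b \<epsilon>\<^sub>1 \<epsilon>\<^sub>2"
    and "\<not> (b \<epsilon>\<^sub>1 w = 0 \<and> b \<epsilon>\<^sub>2 w = 0)"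
    and "f = f_w q b \<epsilon>\<^sub>1 \<epsilon>\<^sub>2 w"
  shows
    "(\<alpha>\<^sub>1 * \<alpha>\<^sub>2 < \<alpha>\<^sub>1\<^sub>2\<^sup>2 \<longrightarrow>
       (let p = Fin (b \<epsilon>\<^sub>1 w) / Fin (b \<epsilon>\<^sub>2 w);
            u = min p (Fin \<alpha>\<^sub>1 / Fin \<alpha>\<^sub>1\<^sub>2);
            v = p + Fin \<alpha>\<^sub>1\<^sub>2 / Fin \<alpha>\<^sub>2;
            A = {0..u}; B = {u..v}; C = {v..Infty}
        in f constant_on A \<and> f constant_on C \<and>
           piecewise_monomial (\<lambda>x. Fin (f x)) u v \<and>
           (\<forall>I\<subseteq>B. order_convex I \<and> (\<exists>x\<in>I. \<exists>y\<in>I. x \<noteq> y) \<longrightarrow> \<not> f constant_on I)))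
     \<and>
     (\<alpha>\<^sub>1 * \<alpha>\<^sub>2 \<ge> \<alpha>\<^sub>1\<^sub>2\<^sup>2 \<longrightarrow>
       (let p = Fin (b \<epsilon>\<^sub>1 w) / Fin (b \<epsilon>\<^sub>2 w);
            m = Fin (square_root (\<alpha>\<^sub>1 / \<alpha>\<^sub>2));
            u = min p m;
            v = p + m;
            A = {0..u}; B = {u..v}; C = {v..Infty}
        in f constant_on A \<and> f constant_on C \<and>
           (\<not> is_singleton B \<longrightarrow>
              piecewise_monomial (\<lambda>x. Fin (f x)) u v \<and>
              (\<forall>I\<subseteq>B. order_convex I \<and> (\<exists>x\<in>I. \<exists>y\<in>I. x \<noteq> y) \<longrightarrow> \<not> f constant_on I)) \<and>
           (is_singleton B \<longrightarrow> f constant_on {0..Infty})))"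
proof -
  interpret quadratic_module smul q b by fact
  let ?a = "b \<epsilon>\<^sub>1 w" and ?c = "b \<epsilon>\<^sub>2 w"
  let ?p = "Fin ?a / Fin ?c"
  have "w \<noteq> 0"
    using \<open>\<not> (b \<epsilon>\<^sub>1 w = 0 \<and> b \<epsilon>\<^sub>2 w = 0)\<close> bilinear_zero_right by auto
  moreover have "\<epsilon>\<^sub>1 \<noteq> 0" "\<epsilon>\<^sub>2 \<noteq> 0"
    using nonzero_if_in_ray \<open>Y\<^sub>1 \<in> rays smul\<close> \<open>\<epsilon>\<^sub>1 \<in> Y\<^sub>1\<close> \<open>Y\<^sub>2 \<in> rays smul\<close> \<open>\<epsilon>\<^sub>2 \<in> Y\<^sub>2\<close> by blast+
  ultimately have nz: "q w \<noteq> 0" "\<alpha>\<^sub>1 \<noteq> 0" "\<alpha>\<^sub>2 \<noteq> 0"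
    using \<open>anisotropic q\<close> \<open>\<alpha>\<^sub>1 = q \<epsilon>\<^sub>1\<close> \<open>\<alpha>\<^sub>2 = q \<epsilon>\<^sub>2\<close> by (auto simp: anisotropic_def)
  have num: "?a \<noteq> 0 \<or> ?c \<noteq> 0"
    using \<open>\<not> (b \<epsilon>\<^sub>1 w = 0 \<and> b \<epsilon>\<^sub>2 w = 0)\<close> by blast
  have f: "f = cs_profile ?a ?c \<alpha>\<^sub>1 \<alpha>\<^sub>1\<^sub>2 \<alpha>\<^sub>2 (q w)"
    using f_w_eq_cs_profile[of q b \<epsilon>\<^sub>1 \<epsilon>\<^sub>2 w] \<open>f = f_w q b \<epsilon>\<^sub>1 \<epsilon>\<^sub>2 w\<close>
      \<open>\<alpha>\<^sub>1 = q \<epsilon>\<^sub>1\<close> \<open>\<alpha>\<^sub>2 = q \<epsilon>\<^sub>2\<close> \<open>\<alpha>\<^sub>1\<^sub>2 = b \<epsilon>\<^sub>1 \<epsilon>\<^sub>2\<close> by simp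

  have shape: "f constant_on {0..u}" "f constant_on {v..Infty}"
      "piecewise_monomial (\<lambda>x. Fin (f x)) u v"
      "\<And>I. I \<subseteq> {u..v} \<Longrightarrow> order_convex I \<Longrightarrow> \<exists>x\<in>I. \<exists>y\<in>I. x \<noteq> y \<Longrightarrow> \<not> f constant_on I"
    if "\<delta> \<noteq> 0" "\<alpha>\<^sub>1 * \<alpha>\<^sub>2 \<le> \<delta>\<^sup>2" "f = cs_profile ?a ?c \<alpha>\<^sub>1 \<delta> \<alpha>\<^sub>2 (q w)"
      "u = min ?p (Fin \<alpha>\<^sub>1 / Fin \<delta>)" "v = ?p + Fin \<delta> / Fin \<alpha>\<^sub>2" for \<delta> u v
  proof -
    interpret profile: dominant_profile ?a ?c \<alpha>\<^sub>1 \<delta> \<alpha>\<^sub>2 "q w"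
      using num nz that by unfold_locales auto
    show "f constant_on {0..u}"
      using profile.constant_on_left that by simp
    show "f constant_on {v..Infty}"
      using profile.constant_on_right that by (simp add: plus_with_infty_eq_max)
    have chain: "nonconstant_monomial_chain (\<lambda>t. Fin (f t)) u v"
      using profile.chain_between that by (simp add: plus_with_infty_eq_max)
    show "piecewise_monomial (\<lambda>x. Fin (f x)) u v"
      using chain by (rule piecewise_monomial_if_chain)
    show "\<not> f constant_on I"
      if "I \<subseteq> {u..v}" "order_convex I" "\<exists>x\<in>I. \<exists>y\<in>I. x \<noteq> y" for I
      using chain that by (rule chain_not_constant_on_subinterval)
  qed

  show ?thesis
  proof (intro conjI impI)
    assume less: "\<alpha>\<^sub>1 * \<alpha>\<^sub>2 < \<alpha>\<^sub>1\<^sub>2\<^sup>2"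
    then have "\<alpha>\<^sub>1\<^sub>2 \<noteq> 0" using zero_le_bipotent[of "\<alpha>\<^sub>1 * \<alpha>\<^sub>2"] by auto
    note shape = shape[OF this less_imp_le[OF less] f refl refl]
    show "let p = ?p; u = min p (Fin \<alpha>\<^sub>1 / Fin \<alpha>\<^sub>1\<^sub>2); v = p + Fin \<alpha>\<^sub>1\<^sub>2 / Fin \<alpha>\<^sub>2;
            A = {0..u}; B = {u..v}; C = {v..Infty}
        in f constant_on A \<and> f constant_on C \<and>
           piecewise_monomial (\<lambda>x. Fin (f x)) u v \<and>
           (\<forall>I\<subseteq>B. order_convex I \<and> (\<exists>x\<in>I. \<exists>y\<in>I. x \<noteq> y) \<longrightarrow> \<not> f constant_on I)"
      unfolding Let_def using shape by blast
  next
    assume le: "\<alpha>\<^sub>1\<^sub>2\<^sup>2 \<le> \<alpha>\<^sub>1 * \<alpha>\<^sub>2"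
    define m where "m = square_root (\<alpha>\<^sub>1 / \<alpha>\<^sub>2)"
    define u where "u = min ?p (Fin m)"
    define v where "v = ?p + Fin m"
    \<comment> \<open>The linear term may be exchanged for \<open>\<surd>(\<alpha>\<^sub>1 \<alpha>\<^sub>2) \<lambda>\<close>, which makes both thresholds equal to \<open>m\<close>.\<close>
    define \<delta> where "\<delta> = \<alpha>\<^sub>2 * m"
    have m2: "\<alpha>\<^sub>2 * m\<^sup>2 = \<alpha>\<^sub>1"
      using nz by (simp add: m_def square_root_power2 times_divide_bipotent)
    then have \<delta>2: "\<delta>\<^sup>2 = \<alpha>\<^sub>1 * \<alpha>\<^sub>2"
      by (simp add: \<delta>_def power2_eq_square mult_ac)
    have "\<delta> \<noteq> 0" using \<delta>2 nz by auto
    have "\<alpha>\<^sub>1 / \<delta> = m" "\<delta> / \<alpha>\<^sub>2 = m"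
      using nz \<open>\<delta> \<noteq> 0\<close> m2
      by (simp_all add: divide_eq_iff_bipotent) (simp_all add: \<delta>_def power2_eq_square mult_ac)
    then have uv: "u = min ?p (Fin \<alpha>\<^sub>1 / Fin \<delta>)" "v = ?p + Fin \<delta> / Fin \<alpha>\<^sub>2"
      using nz \<open>\<delta> \<noteq> 0\<close> by (simp_all add: u_def v_def Fin_divide)
    have "f = cs_profile ?a ?c \<alpha>\<^sub>1 \<delta> \<alpha>\<^sub>2 (q w)"
      unfolding f using le \<delta>2 by (intro cs_profile_absorb) auto
    note shape = shape[OF \<open>\<delta> \<noteq> 0\<close> eq_refl[OF \<delta>2[symmetric]] this uv]
    have "u \<le> v"
      by (simp add: u_def v_def plus_with_infty_eq_max min.coboundedI1)
    have const: "f constant_on {0..Infty}" if "is_singleton {u..v}"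
    proof -
      have "u = v" using that \<open>u \<le> v\<close> by (auto elim!: is_singletonE simp: set_eq_iff) (metis order_refl)
      obtain y z where y: "\<And>t. t \<in> {0..u} \<Longrightarrow> f t = y" and z: "\<And>t. t \<in> {u..Infty} \<Longrightarrow> f t = z"
        using shape(1,2) \<open>u = v\<close> unfolding constant_on_def by metis
      have "y = z" using y[of u] z[of u] by (simp add: zero_le_with_infty)
      then have "f t = y" for t using y[of t] z[of t] by (cases "t \<le> u") (auto simp: zero_le_with_infty)
      then show ?thesis by (auto simp: constant_on_def)
    qed
    show "let p = ?p; m = Fin (square_root (\<alpha>\<^sub>1 / \<alpha>\<^sub>2)); u = min p m; v = p + m;
            A = {0..u}; B = {u..v}; C = {v..Infty}
        in f constant_on A \<and> f constant_on C \<and>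
           (\<not> is_singleton B \<longrightarrow>
              piecewise_monomial (\<lambda>x. Fin (f x)) u v \<and>
              (\<forall>I\<subseteq>B. order_convex I \<and> (\<exists>x\<in>I. \<exists>y\<in>I. x \<noteq> y) \<longrightarrow> \<not> f constant_on I)) \<and>
           (is_singleton B \<longrightarrow> f constant_on {0..Infty})"
      unfolding Let_def m_def[symmetric] u_def[symmetric] v_def[symmetric]
      using shape const by blast
  qed
qed

end
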